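(* Let $d\ge 2$ be an integer and $a\in\mathbb{Q}^*$. For $b\in\{1,-1\}$ let $\psi_{d,a,b}(z)=\frac{z}{az^d+b}$, viewed as a map $\mathbb{P}^1\to\mathbb{P}^1$. Then: (a) $\psi_{d,a,1}$ has no fixed point other than $z=0$. (b) $\psi_{d,a,-1}$ has at most two rational fixed points (including $z=0$) if $d$ is odd, and at most three rational fixed points (including $z=0$) if $d$ is even. (c) Every rational periodic cycle of $\psi_{d,a,1}$ has length $1$ or $2$; a rational periodic cycle of length $2$ exists only if $d$ is even, and in that case there is at most one such cycle. (d) $\psi_{d,a,-1}$ has no rational periodic cycle of length at least $2$.
   Context: In homogeneous coordinates $\psi_{d,a,b}([X,Y]) = [XY^{d-1}, aX^d+bY^d]$. A rational fixed point is a point of $\mathbb{P}^1(\mathbb{Q})$ fixed by the map. A rational periodic cycle of length $n$ is a set of $n$ distinct points $z_1,\dots,z_n\in\mathbb{P}^1(\mathbb{Q})$ with $\psi(z_i)=z_{i+1}$ for $i<n$ and $\psi(z_n)=z_1$. *)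

theory Defs
  imports Complex_Main
begin

definition proj_rel :: "'a::field \<times> 'a \<Rightarrow> 'a \<times> 'a \<Rightarrow> bool" where
  "proj_rel p q \<longleftrightarrow> p \<noteq> (0, 0) \<and> q \<noteq> (0, 0) \<and>
     (\<exists>c. c \<noteq> 0 \<and> q = (c * fst p, c * snd p))"

lemma proj_rel_part_equivp: "part_equivp (proj_rel :: 'a::field \<times> 'a \<Rightarrow> _)"
proof (rule part_equivpI)
  show "\<exists>x :: 'a \<times> 'a. proj_rel x x"
    by (rule exI[of _ "(0, 1)"]) (auto simp: proj_rel_def intro!: exI[of _ 1])
  show "symp (proj_rel :: 'a \<times> 'a \<Rightarrow> _)"
  proof (rule sympI)
    fix p q :: "'a \<times> 'a"
    assume "proj_rel p q"
    then obtain c where "p \<noteq> (0, 0)" "q \<noteq> (0, 0)" "c \<noteq> 0"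
      "q = (c * fst p, c * snd p)"
      unfolding proj_rel_def by blast
    then show "proj_rel q p"
      unfolding proj_rel_def by (intro conjI exI[of _ "inverse c"]) (auto simp: field_simps)
  qed
  show "transp (proj_rel :: 'a \<times> 'a \<Rightarrow> _)"
  proof (rule transpI)
    fix p q r :: "'a \<times> 'a"
    assume "proj_rel p q" "proj_rel q r"
    then obtain c e where "p \<noteq> (0, 0)" "r \<noteq> (0, 0)" "c \<noteq> 0" "e \<noteq> 0"
      "q = (c * fst p, c * snd p)" "r = (e * fst q, e * snd q)"
      unfolding proj_rel_def by blast
    then show "proj_rel p r"
      unfolding proj_rel_def by (intro conjI exI[of _ "e * c"]) (auto simp: mult.assoc)
  qed
qed

text \<open>The points of $P^1(K)$ for the field $K$ given by the type argument.\<close>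

quotient_type (overloaded) 'a proj_line = "'a::field \<times> 'a" / partial: proj_rel
  by (rule proj_rel_part_equivp)

text \<open>\<open>hpoint X Y\<close> is the point $[X,Y]$; it is meaningful only if \<open>(X, Y) \<noteq> (0, 0)\<close>.\<close>

definition hpoint :: "'a::field \<Rightarrow> 'a \<Rightarrow> 'a proj_line" where
  "hpoint X Y = abs_proj_line (X, Y)"

definition apoint :: "'a::field \<Rightarrow> 'a proj_line" where
  "apoint z = hpoint z 1"

lemma hpoint_eq_iff:
  assumes "(X, Y) \<noteq> (0, 0)" "(X', Y') \<noteq> (0, 0)"
  shows "hpoint X Y = hpoint X' Y' \<longleftrightarrow> (\<exists>c. c \<noteq> 0 \<and> X' = c * X \<and> Y' = c * Y)"
proof -
  have refl: "proj_rel p p" if "p \<noteq> (0, 0)" for p :: "'a \<times> 'a"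
    using that by (auto simp: proj_rel_def intro!: exI[of _ 1])
  have "hpoint X Y = hpoint X' Y' \<longleftrightarrow> proj_rel (X, Y) (X', Y')"
    using Quotient_rel_abs2[OF Quotient_proj_line] Quotient_rel[OF Quotient_proj_line]
      refl[OF assms(1)] refl[OF assms(2)]
    unfolding hpoint_def by metis
  then show ?thesis
    using assms by (auto simp: proj_rel_def)
qed

text \<open>The map $[X,Y] \mapsto [XY^{d-1}, aX^d+bY^d]$, computed on an arbitrarily chosen
  representative. For \<open>d \<ge> 2\<close>, \<open>a \<noteq> 0\<close> and \<open>b \<noteq> 0\<close> the choice is irrelevant,
  see \<open>psi_hpoint\<close> below.\<close>

definition psi :: "nat \<Rightarrow> 'a::field \<Rightarrow> 'a \<Rightarrow> 'a proj_line \<Rightarrow> 'a proj_line" where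
  "psi d a b P = (case rep_proj_line P of
     (X, Y) \<Rightarrow> hpoint (X * Y ^ (d - 1)) (a * X ^ d + b * Y ^ d))"

lemma psi_form_nonzero:
  fixes a b :: "'a::field"
  assumes "d \<ge> 2" "a \<noteq> 0" "b \<noteq> 0" "(X, Y) \<noteq> (0, 0)"
  shows "(X * Y ^ (d - 1), a * X ^ d + b * Y ^ d) \<noteq> (0, 0)"
  using assms by (cases "X = 0"; cases "Y = 0") (auto simp: power_0_left)

lemma psi_hpoint:
  fixes a b :: "'a::field"
  assumes "d \<ge> 2" "a \<noteq> 0" "b \<noteq> 0" "(X, Y) \<noteq> (0, 0)"
  shows "psi d a b (hpoint X Y) = hpoint (X * Y ^ (d - 1)) (a * X ^ d + b * Y ^ d)"
proof -
  obtain X' Y' where XY': "rep_proj_line (hpoint X Y) = (X', Y')"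
    by fastforce
  have "proj_rel (X, Y) (X, Y)"
    using assms(4) by (auto simp: proj_rel_def intro!: exI[of _ 1])
  then have "proj_rel (X', Y') (X, Y)"
    using rep_abs_rsp_left[OF Quotient3_proj_line, of "(X, Y)" "(X, Y)"] XY'
    by (simp add: hpoint_def)
  then obtain c where c: "(X', Y') \<noteq> (0, 0)" "c \<noteq> 0" "X = c * X'" "Y = c * Y'"
    by (auto simp: proj_rel_def)
  have "c ^ d = c * c ^ (d - 1)"
    using assms(1) by (metis One_nat_def Suc_1 Suc_le_D diff_Suc_1 power_Suc)
  then have "X * Y ^ (d - 1) = c ^ d * (X' * Y' ^ (d - 1))"
    "a * X ^ d + b * Y ^ d = c ^ d * (a * X' ^ d + b * Y' ^ d)"
    by (simp_all add: c power_mult_distrib algebra_simps)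
  then have "hpoint (X' * Y' ^ (d - 1)) (a * X' ^ d + b * Y' ^ d)
      = hpoint (X * Y ^ (d - 1)) (a * X ^ d + b * Y ^ d)"
    using hpoint_eq_iff[OF psi_form_nonzero[OF assms(1-3) c(1)] psi_form_nonzero[OF assms]] c(2)
    by (metis power_not_zero)
  then show ?thesis
    by (simp add: psi_def XY')
qed

lemma psi_apoint:
  fixes a b z :: "'a::field"
  assumes "d \<ge> 2" "a \<noteq> 0" "b \<noteq> 0" "a * z ^ d + b \<noteq> 0"
  shows "psi d a b (apoint z) = apoint (z / (a * z ^ d + b))"
proof -
  have "psi d a b (apoint z) = hpoint z (a * z ^ d + b)"
    using psi_hpoint[OF assms(1-3), of z 1] by (simp add: apoint_def)
  also have "\<dots> = apoint (z / (a * z ^ d + b))"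
    unfolding apoint_def
    by (subst hpoint_eq_iff)
      (use assms(4) in \<open>auto intro!: exI[of _ "inverse (a * z ^ d + b)"] simp: divide_inverse mult.commute\<close>)
  finally show ?thesis .
qed

definition fixed_points :: "('p \<Rightarrow> 'p) \<Rightarrow> 'p set" where
  "fixed_points f = {P. f P = P}"

text \<open>A periodic cycle is the set of its points, so cyclic relabellings
  give the same cycle.\<close>

definition periodic_cycle :: "('p \<Rightarrow> 'p) \<Rightarrow> nat \<Rightarrow> 'p set \<Rightarrow> bool" where
  "periodic_cycle f n C \<longleftrightarrow> n \<ge> 1 \<and>
     (\<exists>z. inj_on z {1..n} \<and> C = z ` {1..n} \<and>
        (\<forall>i\<in>{1..<n}. f (z i) = z (i + 1)) \<and> f (z n) = z 1)"

end

theory Submission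
  imports Defs
begin

text \<open>Conjugating by \<open>u = a z\<^sup>d\<close> turns \<open>\<psi>\<close> into \<open>u \<mapsto> u / (u + b)\<^sup>d\<close>. If \<open>u = r / s\<close> in lowest
  terms, then \<open>r s\<^bsup>d-1\<^esup> / (r + b s)\<^sup>d\<close> is again in lowest terms, because \<open>b\<close> is a unit. So the absolute
  value of the numerator never decreases along an orbit, and on a cycle avoiding \<open>0\<close> and \<open>\<infinity>\<close> it must
  be constant. This forces \<open>s = 1\<close> at every point of the cycle, hence also \<open>r + b = \<plusminus>1\<close>, which means
  that \<open>\<psi>\<close> acts on the cycle by \<open>z \<mapsto> z\<close> or \<open>z \<mapsto> -z\<close>.\<close>

section \<open>Rational numbers in lowest terms\<close>

definition rat_num :: "rat \<Rightarrow> int" where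
  "rat_num x = fst (quotient_of x)"

definition rat_den :: "rat \<Rightarrow> int" where
  "rat_den x = snd (quotient_of x)"

lemma rat_den_pos: "rat_den x > 0"
  by (simp add: rat_den_def quotient_of_denom_pos')

lemma coprime_rat_num_den: "coprime (rat_num x) (rat_den x)"
  unfolding rat_num_def rat_den_def by (rule quotient_of_coprime) simp

lemma rat_num_div_den: "x = of_int (rat_num x) / of_int (rat_den x)"
  unfolding rat_num_def rat_den_def by (rule quotient_of_div) simp

lemma rat_num_eq_0_iff: "rat_num x = 0 \<longleftrightarrow> x = 0"
proof
  assume "rat_num x = 0"
  then show "x = 0"
    using rat_num_div_den[of x] by (metis div_0 of_int_0)
qed (simp add: rat_num_def)

text \<open>Normalising a coprime pair only makes the denominator positive, so numerator and
  denominator are preserved up to sign.\<close>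

lemma rat_num_den_of_coprime:
  fixes p q :: int
  assumes "coprime p q" "q \<noteq> 0"
  shows "\<bar>rat_num (of_int p / of_int q)\<bar> = \<bar>p\<bar>" "rat_den (of_int p / of_int q) = \<bar>q\<bar>"
proof -
  have "of_int p / of_int q = Fract p q"
    by (simp add: Fract_of_int_quotient)
  then have "quotient_of (of_int p / of_int q) = Rat.normalize (p, q)"
    by (simp add: quotient_of_Fract)
  with assms show "\<bar>rat_num (of_int p / of_int q)\<bar> = \<bar>p\<bar>" "rat_den (of_int p / of_int q) = \<bar>q\<bar>"
    by (auto simp: rat_num_def rat_den_def Rat.normalize_def coprime_iff_gcd_eq_1)
qed

text \<open>With \<open>u = r / s\<close>, both gcd(r + b s, s) and gcd(r, r + b s) reduce to gcd(r,
  s) = 1, the second because \<open>b\<close> is a unit. The first formula drives the monotonicity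
  along orbits; the second recovers \<open>r + b * s\<close> up to sign once denominators are known
  to be 1.\<close>

lemma rat_num_den_step:
  fixes u :: rat and b :: int and d :: nat
  assumes "d \<ge> 1" "\<bar>b\<bar> = 1" "u + of_int b \<noteq> 0"
  shows "\<bar>rat_num (u / (u + of_int b) ^ d)\<bar> = \<bar>rat_num u\<bar> * rat_den u ^ (d - 1)"
    and "rat_den (u / (u + of_int b) ^ d) = \<bar>rat_num u + b * rat_den u\<bar> ^ d"
proof -
  define r s where "r = rat_num u" and "s = rat_den u"
  have s: "s > 0" and cop: "coprime r s" and u: "u = of_int r / of_int s"
    unfolding r_def s_def by (rule rat_den_pos coprime_rat_num_den rat_num_div_den)+
  have sum: "u + of_int b = of_int (r + b * s) / of_int s"
    using s u by (simp add: field_simps)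
  then have nz: "r + b * s \<noteq> 0"
    using assms(3) by (metis div_0 of_int_0)
  have "coprime (r + b * s) s"
    using cop by (metis coprime_iff_gcd_eq_1 gcd.commute gcd_add_mult add.commute)
  moreover have "coprime r (b * s)"
    using cop assms(2) by (metis abs_1 coprime_abs_right_iff coprime_mult_right_iff coprime_1_right)
  then have "coprime r (r + b * s)"
    by (metis coprime_iff_gcd_eq_1 gcd_add2)
  ultimately have "coprime (r * s ^ (d - 1)) ((r + b * s) ^ d)"
    by (simp add: coprime_commute)
  \<comment> \<open>Clearing denominators gives (r / s) * s^d; one factor s cancels, which is
    possible since \<open>d >= 1\<close>.\<close>
  moreover have "u / (u + of_int b) ^ d = of_int (r * s ^ (d - 1)) / of_int ((r + b * s) ^ d)"
    unfolding sum using u s nz assms(1)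
    by (cases d) (simp_all add: field_simps)
  ultimately show "\<bar>rat_num (u / (u + of_int b) ^ d)\<bar> = \<bar>rat_num u\<bar> * rat_den u ^ (d - 1)"
    and "rat_den (u / (u + of_int b) ^ d) = \<bar>rat_num u + b * rat_den u\<bar> ^ d"
    using rat_num_den_of_coprime[of "r * s ^ (d - 1)" "(r + b * s) ^ d"] nz s
    by (simp_all add: r_def s_def abs_mult power_abs)
qed

text \<open>A finite set permuted by \<open>g\<close> replaces the cycle: numerators that never
  decrease under \<open>g\<close> but have an invariant sum over the set must be constant. Since
  \<open>g\<close> divides z by \<open>a * z ^ d + of_int b\<close>, the conclusion says that it
  acts by a sign.\<close>

lemma rational_cycle_multiplier:
  fixes a z :: rat and b :: int and d :: nat and S :: "rat set"
  defines "g \<equiv> \<lambda>z. z / (a * z ^ d + of_int b)"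
  assumes d: "d \<ge> 2" and a: "a \<noteq> 0" and b: "\<bar>b\<bar> = 1"
    and fin: "finite S" and inj: "inj_on g S" and maps: "g ` S \<subseteq> S"
    and nz: "\<And>z. z \<in> S \<Longrightarrow> z \<noteq> 0 \<and> a * z ^ d + of_int b \<noteq> 0"
    and z: "z \<in> S"
  shows "a * z ^ d + of_int b = 1 \<or> a * z ^ d + of_int b = -1"
proof -
  define h where "h z = \<bar>rat_num (a * z ^ d)\<bar>" for z
  \<comment> \<open>For even \<open>d\<close> the points z and -z share the same u, so the argument
    sums over the points z and not over the values u.\<close>
  have conj: "a * g z ^ d = (a * z ^ d) / (a * z ^ d + of_int b) ^ d" for z
    by (simp add: g_def power_divide)
  have h_step: "h (g z) = h z * rat_den (a * z ^ d) ^ (d - 1)" if "z \<in> S" for z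
    unfolding h_def conj using rat_num_den_step(1)[of d b] d b nz[OF that] by simp
  have den_pow: "1 \<le> rat_den (a * z ^ d) ^ (d - 1)" for z
    by (rule one_le_power) (use rat_den_pos[of "a * z ^ d"] in linarith)
  have h_mono: "h z \<le> h (g z)" if "z \<in> S" for z
    unfolding h_step[OF that] using mult_left_mono[OF den_pow, of "h z"] by (simp add: h_def)
  \<comment> \<open>As \<open>g\<close> permutes \<open>S\<close>, the two sums agree; together with
    the termwise inequality this forces equality in every term.\<close>
  have "sum h S = sum h (g ` S)"
    using endo_inj_surj[OF fin maps inj] by simp
  also have "\<dots> = (\<Sum>z\<in>S. h (g z))"
    using inj by (simp add: sum.reindex)
  finally have h_const: "h z = h (g z)" if "z \<in> S" for z
    by (rule sum_mono_inv) (use h_mono fin that in auto)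
  have den: "rat_den (a * z ^ d) = 1" if "z \<in> S" for z
  proof -
    \<comment> \<open>A nonzero numerator can be cancelled from \<open>h_step\<close>; the exponent
      \<open>d - 1\<close> is positive, so the denominator itself is 1.\<close>
    have "h z \<noteq> 0"
      using nz[OF that] a by (simp add: h_def rat_num_eq_0_iff)
    then have "rat_den (a * z ^ d) ^ (d - 1) = 1"
      using h_step[OF that] h_const[OF that] by (metis mult_cancel_left1)
    then show ?thesis
      using rat_den_pos[of "a * z ^ d"] d
        power_eq_iff_eq_base[of "d - 1" "rat_den (a * z ^ d)" 1] by simp
  qed
  \<comment> \<open>The denominator is also 1 at the next point, where it equals the
    \<open>d\<close>-th power of the absolute value of r + b s with s = 1.\<close>
  have "g z \<in> S"
    using maps z by blast
  then have "\<bar>rat_num (a * z ^ d) + b * rat_den (a * z ^ d)\<bar> ^ d = 1"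
    using den[of "g z"] rat_num_den_step(2)[of d b "a * z ^ d"] d b nz[OF z]
    by (simp add: conj)
  then have "\<bar>rat_num (a * z ^ d) + b\<bar> = 1"
    using den[OF z] d power_eq_iff_eq_base[of d "\<bar>rat_num (a * z ^ d) + b\<bar>" 1] by simp
  then have "rat_num (a * z ^ d) + b = 1 \<or> rat_num (a * z ^ d) + b = -1"
    by linarith
  moreover have "a * z ^ d + of_int b = of_int (rat_num (a * z ^ d) + b)"
    using rat_num_div_den[of "a * z ^ d"] den[OF z] by (metis div_by_1 of_int_1 of_int_add)
  ultimately show ?thesis
    by (elim disjE) simp_all
qed

section \<open>The affine chart and the special values of the map\<close>

lemma apoint_eq_iff [simp]: "apoint z = apoint w \<longleftrightarrow> z = w"
  unfolding apoint_def by (subst hpoint_eq_iff) auto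

lemma apoint_neq_infinity [simp]: "apoint z \<noteq> hpoint 1 0"
  unfolding apoint_def by (subst hpoint_eq_iff) auto

lemmas infinity_neq_apoint [simp] = apoint_neq_infinity[symmetric]

lemma proj_line_cases:
  obtains (infinity) "P = hpoint 1 0" | (affine) z where "P = apoint z"
proof -
  obtain X Y where XY: "rep_proj_line P = (X, Y)"
    by fastforce
  have "proj_rel (X, Y) (X, Y)"
    using Quotient_rep_reflp[OF Quotient_proj_line, of P] XY by simp
  then have nz: "(X, Y) \<noteq> (0, 0)"
    by (auto simp: proj_rel_def)
  have P: "P = hpoint X Y"
    using Quotient_abs_rep[OF Quotient_proj_line, of P] XY by (simp add: hpoint_def)
  show thesis
  proof (cases "Y = 0")
    case True
    with nz have "P = hpoint 1 0"
      unfolding P by (subst hpoint_eq_iff) (auto intro!: exI[of _ "inverse X"])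
    then show thesis by (rule infinity)
  next
    case False
    with nz have "P = apoint (X / Y)"
      unfolding P apoint_def
      by (subst hpoint_eq_iff) (auto intro!: exI[of _ "inverse Y"] simp: divide_inverse mult.commute)
    then show thesis by (rule affine)
  qed
qed

text \<open>Together with \<open>psi_pole\<close> and \<open>psi_zero\<close> this gives the orbit
  pole, infinity, 0, 0, ..., so a cycle of length at least 2 avoids all of these points.\<close>

lemma psi_infinity:
  assumes "d \<ge> 2" "a \<noteq> 0" "b \<noteq> 0"
  shows "psi d a b (hpoint 1 0) = apoint 0"
proof -
  have "psi d a b (hpoint 1 0) = hpoint 0 a"
    using psi_hpoint[OF assms, of 1 0] assms(1) by (simp add: power_0_left)
  also have "\<dots> = apoint 0"
    unfolding apoint_def using assms(2)
    by (subst hpoint_eq_iff) (auto intro!: exI[of _ "inverse a"])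
  finally show ?thesis .
qed

lemma psi_pole:
  assumes "d \<ge> 2" "a \<noteq> 0" "b \<noteq> 0" "a * z ^ d + b = 0"
  shows "psi d a b (apoint z) = hpoint 1 0"
proof -
  have z: "z \<noteq> 0"
    using assms by (auto simp: power_0_left)
  have "psi d a b (apoint z) = hpoint z 0"
    using psi_hpoint[OF assms(1-3), of z 1] assms(4) by (simp add: apoint_def)
  also have "\<dots> = hpoint 1 0"
    using z by (subst hpoint_eq_iff) (auto intro!: exI[of _ "inverse z"])
  finally show ?thesis .
qed

lemma psi_zero:
  assumes "d \<ge> 2" "a \<noteq> 0" "b \<noteq> 0"
  shows "psi d a b (apoint 0) = apoint 0"
  using psi_apoint[OF assms, of 0] assms by (simp add: power_0_left)

text \<open>Infinity goes to 0 and poles go to infinity, so only affine non-poles can be fixed, and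
  there z cancels unless it is 0. For \<open>b = 1\<close> the equation has no further solution; for
  \<open>b = -1\<close> it reads \<open>z ^ d = 2 / a\<close>.\<close>

lemma fixed_points_psi:
  fixes a b :: "'a::field"
  assumes "d \<ge> 2" "a \<noteq> 0" "b \<noteq> 0"
  shows "fixed_points (psi d a b) = apoint ` ({0} \<union> {z. a * z ^ d + b = 1})"
proof (rule set_eqI)
  fix P
  show "P \<in> fixed_points (psi d a b) \<longleftrightarrow> P \<in> apoint ` ({0} \<union> {z. a * z ^ d + b = 1})"
  proof (cases P rule: proj_line_cases)
    case infinity
    then show ?thesis
      using psi_infinity[OF assms] by (auto simp: fixed_points_def)
  next
    case (affine z)
    show ?thesis
    proof (cases "a * z ^ d + b = 0")
      case True
      then have "z \<noteq> 0"
        using assms by (auto simp: power_0_left)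
      with True show ?thesis
        using psi_pole[OF assms True] affine by (auto simp: fixed_points_def)
    next
      case False
      have "z / (a * z ^ d + b) = z \<longleftrightarrow> z = 0 \<or> a * z ^ d + b = 1"
        using False by (auto simp: divide_eq_eq)
      then show ?thesis
        using psi_apoint[OF assms False] affine by (auto simp: fixed_points_def)
    qed
  qed
qed

section \<open>Rational roots of pure powers\<close>

text \<open>In an ordered ring equal powers force equal absolute values, and the parity of
  \<open>d\<close> decides whether the sign may differ.\<close>

lemma power_eq_power_cases:
  fixes z w :: "'a::linordered_idom"
  assumes "z ^ d = w ^ d" "d \<ge> 1"
  shows "z = w \<or> even d \<and> z = - w"
proof -
  have "\<bar>z\<bar> ^ d = \<bar>w\<bar> ^ d"
    using assms(1) by (metis power_abs)
  then have "\<bar>z\<bar> = \<bar>w\<bar>"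
    using assms(2) by (simp add: power_eq_iff_eq_base)
  moreover have "z = w" if "z = - w" "odd d"
  proof -
    have "- (w ^ d) = w ^ d"
      using assms(1) that by (simp add: power_minus_odd)
    then have "w ^ d = 0" by simp
    then show ?thesis using that by simp
  qed
  ultimately show ?thesis by (metis abs_eq_iff)
qed

lemma finite_card_nth_roots_rat:
  fixes c :: rat
  assumes "d \<ge> 1"
  shows "finite {z. z ^ d = c}" "card {z. z ^ d = c} \<le> (if even d then 2 else 1)"
proof -
  have "finite {z. z ^ d = c} \<and> card {z. z ^ d = c} \<le> (if even d then 2 else 1)"
  proof (cases "{z. z ^ d = c} = {}")
    case False
    then obtain w where w: "w ^ d = c" by blast
    define A where "A = (if even d then {w, -w} else {w})"
    have "z \<in> A" if "z ^ d = c" for z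
      using power_eq_power_cases[of z d w] that w assms by (auto simp: A_def)
    then have sub: "{z. z ^ d = c} \<subseteq> A" by blast
    moreover have "finite A" "card A \<le> (if even d then 2 else 1)"
      unfolding A_def by (auto intro: order.trans[OF card_insert_le_m1])
    ultimately show ?thesis
      by (meson card_mono finite_subset order.trans)
  qed simp
  then show "finite {z. z ^ d = c}" "card {z. z ^ d = c} \<le> (if even d then 2 else 1)"
    by blast+
qed

section \<open>General facts on periodic cycles\<close>

lemma periodic_cycle_finite: "periodic_cycle f n C \<Longrightarrow> finite C"
  by (auto simp: periodic_cycle_def)

lemma periodic_cycle_nonempty: "periodic_cycle f n C \<Longrightarrow> C \<noteq> {}"
  by (auto simp: periodic_cycle_def)

text \<open>Each point has its successor and its predecessor in the cycle, indices being read
  cyclically. By finiteness this later yields injectivity of \<open>f\<close> on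
  \<open>C\<close>.\<close>

lemma periodic_cycle_image:
  assumes "periodic_cycle f n C"
  shows "f ` C = C"
proof -
  obtain z where z: "n \<ge> 1" "C = z ` {1..n}"
    "\<And>i. i \<in> {1..<n} \<Longrightarrow> f (z i) = z (i + 1)" "f (z n) = z 1"
    using assms unfolding periodic_cycle_def by auto
  have step: "f (z i) \<in> C" if "i \<in> {1..n}" for i
    using that z by (cases "i = n") auto
  have "z i \<in> f ` C" if i: "i \<in> {1..n}" for i
  proof (cases "i = 1")
    case True
    then show ?thesis
      using z by (metis atLeastAtMost_iff imageI le_refl)
  next
    case False
    with i have "i - 1 \<in> {1..<n}" "i - 1 \<in> {1..n}" "i - 1 + 1 = i"
      by auto
    then have "f (z (i - 1)) = z i" "i - 1 \<in> {1..n}"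
      using z(3)[of "i - 1"] by simp_all
    then show ?thesis
      using z(2) by (metis imageI)
  qed
  with step z(2) show ?thesis by blast
qed

text \<open>A fixed point equals its own successor in an injective enumeration, so there is only one
  index.\<close>

lemma periodic_cycle_fixed_point:
  assumes "periodic_cycle f n C" "P \<in> C" "f P = P"
  shows "n = 1"
proof -
  obtain z where z: "n \<ge> 1" "inj_on z {1..n}" "C = z ` {1..n}"
    "\<And>i. i \<in> {1..<n} \<Longrightarrow> f (z i) = z (i + 1)" "f (z n) = z 1"
    using assms(1) unfolding periodic_cycle_def by auto
  obtain i where i: "i \<in> {1..n}" "P = z i"
    using assms(2) z(3) by blast
  show ?thesis
  proof (cases "i = n")
    case True
    then show ?thesis
      using z(1,2,5) i assms(3) by (auto dest: inj_onD)
  next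
    case False
    then have "z (i + 1) = z i" "i + 1 \<in> {1..n}"
      using z(4)[of i] i assms(3) by auto
    then show ?thesis
      using inj_onD[OF z(2), of "i + 1" i] i by simp
  qed
qed

lemma periodic_cycle_length_le_2:
  assumes "periodic_cycle f n C" "\<And>P. P \<in> C \<Longrightarrow> f (f P) = P"
  shows "n \<le> 2"
proof (rule ccontr)
  assume n: "\<not> n \<le> 2"
  obtain z where z: "inj_on z {1..n}" "C = z ` {1..n}"
    "\<And>i. i \<in> {1..<n} \<Longrightarrow> f (z i) = z (i + 1)"
    using assms(1) unfolding periodic_cycle_def by auto
  have "f (z 1) = z 2" "f (z 2) = z 3"
    using z(3)[of 1] z(3)[of 2] n by (simp_all add: numeral_eq_Suc)
  moreover have "z 1 \<in> C"
    using z(2) n by auto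
  ultimately have "z 3 = z 1"
    using assms(2) by metis
  then show False
    using inj_onD[OF z(1), of 3 1] n by simp
qed

lemma periodic_cycle_2E:
  assumes "periodic_cycle f 2 C"
  obtains P where "C = {P, f P}"
proof -
  obtain z where "C = z ` {1..2::nat}" and "f (z 1) = z 2"
    using assms unfolding periodic_cycle_def by (auto simp: numeral_eq_Suc)
  moreover have "{1..2} = {1, 2::nat}" by auto
  ultimately show thesis
    using that[of "z 1"] by simp
qed

section \<open>Rational cycles of the map\<close>

text \<open>Such a cycle contains no fixed point, so it misses 0, hence infinity, hence the poles,
  and lies in the affine chart. There \<open>rational_cycle_multiplier\<close> leaves the values 1
  and -1, and 1 would make \<open>P\<close> fixed.\<close>

lemma psi_rational_cycle:
  fixes a :: rat and b :: int
  assumes d: "d \<ge> 2" and a: "a \<noteq> 0" and b: "\<bar>b\<bar> = 1"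
    and cycle: "periodic_cycle (psi d a (of_int b)) n C" and n: "n \<ge> 2" and P: "P \<in> C"
  shows "\<exists>z. P = apoint z \<and> z \<noteq> 0 \<and> a * z ^ d + of_int b = -1 \<and>
    psi d a (of_int b) P = apoint (- z)"
proof -
  let ?f = "psi d a (of_int b)"
  have b0: "of_int b \<noteq> (0::rat)" using b by auto
  note im = periodic_cycle_image[OF cycle]
  have no_zero: "apoint 0 \<notin> C"
    using periodic_cycle_fixed_point[OF cycle _ psi_zero[OF d a b0]] n by auto
  then have no_inf: "hpoint 1 0 \<notin> C"
    using im psi_infinity[OF d a b0] by (metis imageI)
  define S where "S = {z. apoint z \<in> C}"
  define g where "g z = z / (a * z ^ d + of_int b)" for z
  have nz: "z \<noteq> 0 \<and> a * z ^ d + of_int b \<noteq> 0" if "z \<in> S" for z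
    using that no_zero no_inf im psi_pole[OF d a b0] unfolding S_def
    by (metis imageI mem_Collect_eq)
  have f_g: "?f (apoint z) = apoint (g z)" if "z \<in> S" for z
    using psi_apoint[OF d a b0] nz[OF that] by (simp add: g_def)
  \<comment> \<open>A map of a finite set onto itself is injective; this passes to \<open>g\<close>
    through the affine coordinate.\<close>
  have "inj_on ?f C"
    using im periodic_cycle_finite[OF cycle] by (simp add: eq_card_imp_inj_on)
  then have inj: "inj_on g S"
    using f_g by (intro inj_onI) (metis (no_types, lifting) S_def apoint_eq_iff inj_onD mem_Collect_eq)
  have maps: "g ` S \<subseteq> S"
    using im f_g by (force simp: S_def)
  have "finite (apoint ` S)"
    by (rule finite_subset[OF _ periodic_cycle_finite[OF cycle]]) (auto simp: S_def)
  then have fin: "finite S"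
    by (rule finite_imageD) (simp add: inj_on_def)
  obtain z where z: "P = apoint z"
    using P no_inf by (cases P rule: proj_line_cases) auto
  then have zS: "z \<in> S"
    using P by (simp add: S_def)
  have "a * z ^ d + of_int b = 1 \<or> a * z ^ d + of_int b = -1"
    using rational_cycle_multiplier[OF d a b fin _ _ nz zS] inj maps unfolding g_def by blast
  moreover have "a * z ^ d + of_int b \<noteq> 1"
  proof
    assume "a * z ^ d + of_int b = 1"
    then have "?f P = P"
      using f_g[OF zS] by (simp add: z g_def)
    then show False
      using periodic_cycle_fixed_point[OF cycle P] n by simp
  qed
  ultimately have "a * z ^ d + of_int b = -1" by blast
  then show ?thesis
    using z nz[OF zS] f_g[OF zS] by (auto simp: g_def)
qed

text \<open>The first conjunct ranges over all fields of characteristic 0 because it concerns all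
  fixed points, not only rational ones; the others live over \<open>rat\<close>.\<close>

theorem theorem2p3:
  fixes d :: nat and a :: rat
  assumes "d \<ge> 2" and "a \<noteq> 0"
  shows
    "fixed_points (psi d (of_rat a) 1) = {apoint (0 :: 'k::field_char_0)}
     \<and>
     (apoint 0 \<in> fixed_points (psi d a (-1)) \<and> finite (fixed_points (psi d a (-1))) \<and>
      (odd d \<longrightarrow> card (fixed_points (psi d a (-1))) \<le> 2) \<and>
      (even d \<longrightarrow> card (fixed_points (psi d a (-1))) \<le> 3))
     \<and>
     ((\<forall>n C. periodic_cycle (psi d a 1) n C \<longrightarrow> n = 1 \<or> n = 2) \<and>
      ((\<exists>C. periodic_cycle (psi d a 1) 2 C) \<longrightarrow> even d) \<and>
      (even d \<longrightarrow> (\<exists>\<^sub>\<le>\<^sub>1 C. periodic_cycle (psi d a 1) 2 C)))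
     \<and>
     (\<forall>n C. n \<ge> 2 \<longrightarrow> \<not> periodic_cycle (psi d a (-1)) n C)"
proof (intro conjI)
  show "fixed_points (psi d (of_rat a) 1) = {apoint (0 :: 'k)}"
    using fixed_points_psi[of d "of_rat a :: 'k" 1] assms by auto
next
  \<comment> \<open>The nonzero fixed points solve \<open>a * z ^ d - 1 = 1\<close>; the point 0
    adds one to their number.\<close>
  define R where "R = {z. z ^ d = 2 / a}"
  have fp: "fixed_points (psi d a (-1)) = apoint ` insert 0 R"
    using fixed_points_psi[of d a "-1"] assms by (simp add: R_def field_simps)
  then show "apoint 0 \<in> fixed_points (psi d a (-1))" by simp
  have R: "finite R" "card R \<le> (if even d then 2 else 1)"
    unfolding R_def using finite_card_nth_roots_rat[of d] assms by auto
  then show "finite (fixed_points (psi d a (-1)))"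
    unfolding fp by simp
  have "card (fixed_points (psi d a (-1))) \<le> Suc (card R)"
    unfolding fp using card_image_le[of "insert 0 R" apoint] R(1)
    by (simp add: card_insert_if split: if_splits)
  with R(2) show "odd d \<longrightarrow> card (fixed_points (psi d a (-1))) \<le> 2"
    "even d \<longrightarrow> card (fixed_points (psi d a (-1))) \<le> 3"
    by auto
next
  have pt: "\<exists>z. P = apoint z \<and> z \<noteq> 0 \<and> a * z ^ d = -2 \<and> psi d a 1 P = apoint (- z)"
    if cycle: "periodic_cycle (psi d a 1) n C" "n \<ge> 2" "P \<in> C" for n C P
  proof -
    obtain z where z: "P = apoint z" "z \<noteq> 0" "a * z ^ d + 1 = -1" "psi d a 1 P = apoint (- z)"
      using psi_rational_cycle[of d a 1 n C P] cycle assms by auto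
    from z(3) have "a * z ^ d = -2" by linarith
    with z show ?thesis by blast
  qed
  show "\<forall>n C. periodic_cycle (psi d a 1) n C \<longrightarrow> n = 1 \<or> n = 2"
  proof (intro allI impI)
    fix n C
    assume cycle: "periodic_cycle (psi d a 1) n C"
    show "n = 1 \<or> n = 2"
    proof (cases "n \<ge> 2")
      case True
      \<comment> \<open>The image of \<open>P\<close> lies in the cycle too, so \<open>pt\<close>
        applies twice and the sign changes cancel.\<close>
      have "psi d a 1 (psi d a 1 P) = P" if "P \<in> C" for P
      proof -
        have "psi d a 1 P \<in> C"
          using periodic_cycle_image[OF cycle] that by blast
        then show ?thesis
          using pt[OF cycle True that] pt[OF cycle True, of "psi d a 1 P"] by auto
      qed
      then show ?thesis
        using periodic_cycle_length_le_2[OF cycle] True by force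
    next
      case False
      then show ?thesis
        using cycle by (auto simp: periodic_cycle_def)
    qed
  qed
  show "(\<exists>C. periodic_cycle (psi d a 1) 2 C) \<longrightarrow> even d"
  proof (intro impI)
    assume "\<exists>C. periodic_cycle (psi d a 1) 2 C"
    then obtain C where cycle: "periodic_cycle (psi d a 1) 2 C" by blast
    then obtain P where P: "P \<in> C"
      using periodic_cycle_nonempty by blast
    obtain z where z: "a * z ^ d = -2" "psi d a 1 P = apoint (- z)"
      using pt[OF cycle _ P] by auto
    \<comment> \<open>Both z and -z must satisfy the equation with right side -2; an odd power would
      turn -2 into 2.\<close>
    have "psi d a 1 P \<in> C"
      using periodic_cycle_image[OF cycle] P by blast
    then have "a * (- z) ^ d = -2"
      using pt[OF cycle, of "psi d a 1 P"] z(2) by auto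
    with z(1) show "even d"
      by (cases "even d") (auto simp: power_minus_odd)
  qed
  show "even d \<longrightarrow> (\<exists>\<^sub>\<le>\<^sub>1 C. periodic_cycle (psi d a 1) 2 C)"
  proof (intro impI Uniq_I)
    fix C C'
    assume cycles: "periodic_cycle (psi d a 1) 2 C"
      "periodic_cycle (psi d a 1) 2 C'"
    \<comment> \<open>A 2-cycle is a pair of opposite roots of one equation, whose rational roots
      agree up to sign; the pair does not depend on that sign.\<close>
    have form: "\<exists>z. C = {apoint z, apoint (- z)} \<and> a * z ^ d = -2"
      if "periodic_cycle (psi d a 1) 2 C" for C
      using pt[OF that] periodic_cycle_2E[OF that] by (metis insertI1 order_refl)
    obtain z w where "C = {apoint z, apoint (- z)}" "a * z ^ d = -2"
      "C' = {apoint w, apoint (- w)}" "a * w ^ d = -2"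
      using form[OF cycles(1)] form[OF cycles(2)] by blast
    moreover from this have "z ^ d = w ^ d"
      using assms(2) by (metis mult_left_cancel)
    then have "z = w \<or> z = - w"
      using power_eq_power_cases[of z d w] assms(1) by auto
    ultimately show "C = C'" by auto
  qed
next
  show "\<forall>n C. n \<ge> 2 \<longrightarrow> \<not> periodic_cycle (psi d a (-1)) n C"
  proof (intro allI impI notI)
    fix n C
    assume n: "n \<ge> 2" and cycle: "periodic_cycle (psi d a (-1)) n C"
    then obtain P where P: "P \<in> C"
      using periodic_cycle_nonempty by blast
    \<comment> \<open>For \<open>b = -1\<close> the multiplier -1 would mean
      \<open>a * z ^ d = 0\<close>.\<close>
    obtain z where "z \<noteq> 0" "a * z ^ d + of_int (-1) = -1"
      using psi_rational_cycle[of d a "-1" n C P] assms n cycle P by auto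
    then show False
      using assms by simp
  qed
qed

end
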